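(* Let $\psi$ be a real entire function such that, for every $c\in\mathbb{R}$, $$\psi(\zeta)=o(|\zeta|)\quad\text{as }\zeta\to\infty\text{ in the half-plane }\operatorname{Re}\zeta>c .$$ Then the function $$f(z)=\sum_{n=0}^\infty \frac{e^{i\psi(n)}}{n!}z^n$$ is an entire function of the form $\sum_{n\ge0} a_nz^n/n!$ with $|a_n|=1$ for all $n$, and for every $A>0$ and every $\epsilon>0$ we have $$|f(re^{i\phi})|=O(r^{-A}),\qquad r\to\infty,$$ uniformly for $|\phi-\pi|\le \pi/2-\epsilon$.
   Context: A real entire function is an entire function taking real values on the real axis. *)

theory Defs
  imports "HOL-Complex_Analysis.Complex_Analysis" "HOL-Library.Landau_Symbols"
begin

definition real_entire :: "(complex \<Rightarrow> complex) \<Rightarrow> bool" where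
  "real_entire \<psi> \<longleftrightarrow> \<psi> holomorphic_on UNIV \<and> (\<forall>x::real. \<psi> (complex_of_real x) \<in> \<real>)"

definition at_infinity_right_of :: "real \<Rightarrow> complex filter" where
  "at_infinity_right_of c = inf at_infinity (principal {\<zeta>. Re \<zeta> > c})"

end

(*
  Mellin-Barnes representation: Gamma has residue (-1)^n / n! at -n, so with w = - z and
  G(s) = exp(i psi(s)), the series f(z) = sum (-1)^n G(n) w^n / n! is
  the sum of the residues of Gamma(s) G(-s) w^(-s). The partial sums are contour integrals over the
  rectangles with real part in [1/2 - N, k + 1/2] and imaginary part in [-T, T]. Since psi is
  o(|s|), |G(-s)| grows more slowly than any exp(eta |s|), while |Gamma(s) w^(-s)| decays like
  exp(-eps |t|) when |arg w| <= pi/2 - eps. Hence the horizontal sides vanish as T tends to infinity,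
  the left side as N tends to infinity, and the right side is O(|w|^(-k-1/2)).

  All vertical sides lie on half-integer abscissae, where the exact value
  |Gamma(1/2 + it)|^2 = pi / cosh(pi t) and the functional equation replace Stirling's formula; the
  horizontal sides are handled by the monotonicity of x |-> |Gamma(x + it)| / Gamma(x).
*)
theory Submission
  imports Defs
begin

section \<open>Bounds for Gamma on vertical lines and strips\<close>

text \<open>On this line conjugation is z |-> 1 - z, so the reflection formula evaluates
  |Gamma(z)|^2 as pi / sin(pi z) = pi / cosh(pi t), and cosh(pi t) is at least exp(pi |t|) /
  2.\<close>

lemma cmod_Gamma_half_line:
  "cmod (Gamma (Complex (1/2) t)) \<le> sqrt (2 * pi) * exp (- (pi / 2) * \<bar>t\<bar>)"
proof -
  define z where "z = Complex (1/2) t"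
  have cosh_of_real: "cosh (complex_of_real x) = of_real (cosh x)" for x
    by (simp add: cosh_def scaleR_conv_of_real flip: exp_of_real)
  have cnj: "cnj z = 1 - z" by (simp add: z_def complex_eq_iff)
  \<comment> \<open>The shift by pi/2 turns the sine into the cosine of an imaginary number, which
    is a hyperbolic cosine.\<close>
  have arg: "complex_of_real pi * z = of_real (pi/2) - (- (\<i> * of_real (pi * t)))"
    by (simp add: z_def complex_eq_iff)
  have sin: "sin (complex_of_real pi * z) = cosh (of_real (pi * t))"
    unfolding arg sin_diff by (simp add: cosh_conv_cos cos_of_real sin_of_real)
  have "complex_of_real ((cmod (Gamma z))\<^sup>2) = Gamma z * Gamma (1 - z)"
    by (simp add: complex_norm_square cnj_Gamma cnj del: of_real_power)
  also have "\<dots> = of_real (pi / cosh (pi * t))"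
    unfolding Gamma_reflection_complex sin cosh_of_real by simp
  finally have sq: "(cmod (Gamma z))\<^sup>2 = pi / cosh (pi * t)"
    using of_real_eq_iff by blast
  have "exp (pi * \<bar>t\<bar>) / 2 \<le> cosh (pi * t)"
    by (cases "t \<ge> 0") (auto simp: cosh_def abs_if)
  hence "pi / cosh (pi * t) \<le> pi / (exp (pi * \<bar>t\<bar>) / 2)"
    by (intro divide_left_mono) (auto intro!: mult_pos_pos)
  also have "\<dots> = (sqrt (2 * pi) * exp (- (pi / 2) * \<bar>t\<bar>))\<^sup>2"
    by (simp add: power_mult_distrib exp_minus divide_simps flip: exp_double)
  finally show ?thesis
    unfolding sq[symmetric] z_def[symmetric] by (rule power2_le_imp_le) simp
qed

lemma Complex_notin_nonpos_Ints:
  "x > 0 \<or> t \<noteq> 0 \<Longrightarrow> Complex x t \<notin> \<int>\<^sub>\<le>\<^sub>0"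
  by (auto elim!: nonpos_Ints_cases simp: complex_eq_iff)

text \<open>A parity argument: 1 - 2N is odd. It keeps the left sides of all rectangles off the
  poles of Gamma.\<close>

lemma half_integer_notin_nonpos_Ints: "Complex (1/2 - real N) t \<notin> \<int>\<^sub>\<le>\<^sub>0"
proof
  assume "Complex (1/2 - real N) t \<in> \<int>\<^sub>\<le>\<^sub>0"
  then obtain n where "Complex (1/2 - real N) t = of_int n" by (auto elim: nonpos_Ints_cases)
  hence "1 - 2 * real N = real_of_int (2 * n)" by (simp add: complex_eq_iff)
  hence "1 - 2 * int N = 2 * n" by linarith
  thus False by presburger
qed

text \<open>Each step of the functional equation Gamma(z + 1) = z Gamma(z) multiplies by |z|, and
  all k factors are at most k + |t|.\<close>

lemma cmod_Gamma_right_line: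
  "cmod (Gamma (Complex (real k + 1/2) t))
     \<le> sqrt (2 * pi) * (real k + \<bar>t\<bar>) ^ k * exp (- (pi / 2) * \<bar>t\<bar>)"
proof (induction k)
  case 0
  then show ?case using cmod_Gamma_half_line[of t] by simp
next
  case (Suc k)
  define z where "z = Complex (real k + 1/2) t"
  have z1: "Complex (real (Suc k) + 1/2) t = z + 1" by (simp add: z_def complex_eq_iff)
  have nz: "z \<notin> \<int>\<^sub>\<le>\<^sub>0" unfolding z_def by (rule Complex_notin_nonpos_Ints) auto
  have "cmod z \<le> real (Suc k) + \<bar>t\<bar>"
    using cmod_le[of z] by (simp add: z_def)
  hence "cmod z * cmod (Gamma z)
      \<le> (real (Suc k) + \<bar>t\<bar>) * (sqrt (2 * pi) * (real (Suc k) + \<bar>t\<bar>) ^ k * exp (- (pi / 2) * \<bar>t\<bar>))"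
    using Suc unfolding z_def[symmetric]
    by (intro mult_mono) (auto intro!: mult_right_mono mult_left_mono power_mono elim!: order_trans)
  then show ?case
    unfolding z1 Gamma_plus1[OF nz] norm_mult by (simp add: mult_ac)
qed

text \<open>A step to the left divides by |z|, which is at least |Re z| = N + 1/2 and hence at least
  (N + 1)/2. The resulting factor 1/N! later beats any power that depends on w.\<close>

lemma cmod_Gamma_left_line:
  "cmod (Gamma (Complex (1/2 - real N) t))
     \<le> sqrt (2 * pi) * (2 ^ N / fact N) * exp (- (pi / 2) * \<bar>t\<bar>)"
proof (induction N)
  case 0
  then show ?case using cmod_Gamma_half_line[of t] by simp
next
  case (Suc N)
  define z where "z = Complex (1/2 - real (Suc N)) t"
  have z1: "Complex (1/2 - real N) t = z + 1" by (simp add: z_def complex_eq_iff)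
  have nz: "z \<notin> \<int>\<^sub>\<le>\<^sub>0" unfolding z_def by (rule half_integer_notin_nonpos_Ints)
  have "real (Suc N) / 2 \<le> cmod z"
    using abs_Re_le_cmod[of z] by (simp add: z_def)
  hence "real (Suc N) / 2 * cmod (Gamma z) \<le> cmod (z * Gamma z)"
    unfolding norm_mult by (intro mult_right_mono) auto
  also have "\<dots> \<le> sqrt (2 * pi) * (2 ^ N / fact N) * exp (- (pi / 2) * \<bar>t\<bar>)"
    using Suc unfolding z1 Gamma_plus1[OF nz] .
  finally show ?case
    unfolding z_def[symmetric] by (simp add: divide_simps) (simp add: algebra_simps)
qed

text \<open>By the product formula, |Gamma(x + it)| / Gamma(x) is the limit of products of (x + j) /
  |x + j + it|, and each such factor increases with x. The inequality is cross-multiplied and passes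
  to the limit from \<open>Gamma_series\<close>.\<close>

lemma cmod_Gamma_mono:
  assumes "0 < x" "x \<le> y"
  shows "cmod (Gamma (Complex x t)) * Gamma y \<le> Gamma x * cmod (Gamma (Complex y t))"
proof (rule LIMSEQ_le)
  show "(\<lambda>n. cmod (Gamma_series (Complex x t) n) * Gamma_series y n) \<longlonglongrightarrow> cmod (Gamma (Complex x t)) * Gamma y"
    by (intro tendsto_intros)
  show "(\<lambda>n. Gamma_series x n * cmod (Gamma_series (Complex y t) n)) \<longlonglongrightarrow> Gamma x * cmod (Gamma (Complex y t))"
    by (intro tendsto_intros)
  have poch: "cmod (pochhammer (Complex u t) (n + 1)) = (\<Prod>j=0..n. cmod (Complex (u + real j) t))" for u n
    by (simp add: pochhammer_Suc_prod prod_norm Complex_eq add_ac)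
  have num: "cmod (fact n * exp (Complex u t * of_real (ln (real n)))) = fact n * exp (u * ln (real n))" for u n
    by (simp add: norm_mult)
  show "\<exists>N. \<forall>n\<ge>N. cmod (Gamma_series (Complex x t) n) * Gamma_series y n
      \<le> Gamma_series x n * cmod (Gamma_series (Complex y t) n)"
  proof (intro exI allI impI)
    fix n :: nat
    have pos: "0 < cmod (Complex (u + real j) t)" if "u > 0" for u j
      using that by (auto simp: complex_eq_iff)
    have factor: "(x + real j) * cmod (Complex (y + real j) t) \<le> (y + real j) * cmod (Complex (x + real j) t)" for j
    \<comment> \<open>After squaring, the common term (x + j)^2 (y + j)^2 cancels and only the terms
      with t^2 remain to be compared.\<close>
    proof (rule power2_le_imp_le)
      have "(x + real j)\<^sup>2 * t\<^sup>2 \<le> (y + real j)\<^sup>2 * t\<^sup>2"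
        using assms by (intro mult_right_mono power_mono) auto
      thus "((x + real j) * cmod (Complex (y + real j) t))\<^sup>2 \<le> ((y + real j) * cmod (Complex (x + real j) t))\<^sup>2"
        unfolding power_mult_distrib cmod_power2 complex.sel distrib_left
        by (simp only: mult.commute[of "(y + real j)\<^sup>2" "(x + real j)\<^sup>2"] add_left_mono)
    qed (use assms in auto)
    have "(\<Prod>j=0..n. (x + real j) * cmod (Complex (y + real j) t))
        \<le> (\<Prod>j=0..n. (y + real j) * cmod (Complex (x + real j) t))"
      using assms by (intro prod_mono conjI factor) auto
    hence le: "pochhammer x (n+1) * cmod (pochhammer (Complex y t) (n + 1))
        \<le> pochhammer y (n+1) * cmod (pochhammer (Complex x t) (n + 1))"
      unfolding poch by (simp add: prod.distrib pochhammer_Suc_prod)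
    have P: "pochhammer x (n+1) > 0" "pochhammer y (n+1) > 0"
      using assms by (auto intro!: pochhammer_pos)
    have Q: "cmod (pochhammer (Complex x t) (n + 1)) > 0" "cmod (pochhammer (Complex y t) (n + 1)) > 0"
      unfolding poch using assms by (auto intro!: prod_pos pos simp: complex_eq_iff)
    have "1 / (cmod (pochhammer (Complex x t) (n + 1)) * pochhammer y (n+1))
        \<le> 1 / (pochhammer x (n+1) * cmod (pochhammer (Complex y t) (n + 1)))"
      using le P Q by (intro divide_left_mono) (auto simp: mult_ac)
    \<comment> \<open>The numerators n! n^x and n! n^y occur on both sides, so only the Pochhammer
      denominators matter.\<close>
    from mult_left_mono[OF this, of "(fact n * exp (x * ln (real n))) * (fact n * exp (y * ln (real n)))"]
    show "cmod (Gamma_series (Complex x t) n) * Gamma_series y n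
      \<le> Gamma_series x n * cmod (Gamma_series (Complex y t) n)"
      unfolding Gamma_series_def norm_divide num of_real_eq_id id_apply
      by (simp add: mult_ac)
  qed
qed

text \<open>A single term of the exponential series at \<open>\<eta> * (c + t)\<close> is at most
  the whole series.\<close>

lemma power_le_exp:
  fixes c t \<eta> :: real
  assumes "\<eta> > 0" "c \<ge> 0" "t \<ge> 0"
  shows "(c + t) ^ k \<le> fact k / \<eta> ^ k * exp (\<eta> * c) * exp (\<eta> * t)"
proof -
  have nonneg: "0 \<le> \<eta> * (c + t)" using assms by simp
  have "(\<eta> * (c + t)) ^ k / fact k \<le> (\<Sum>n. (\<eta> * (c + t)) ^ n / fact n)"
    using nonneg summable_exp_generic[of "\<eta> * (c + t)"]
    by (intro order.trans[OF _ sum_le_suminf[of _ "{k}"]]) (auto simp: divide_inverse mult_ac)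
  also have "\<dots> = exp (\<eta> * (c + t))" by (simp add: exp_def divide_inverse mult_ac)
  finally show ?thesis
    using assms unfolding power_mult_distrib
    by (simp add: pos_divide_le_eq pos_le_divide_eq mult_ac exp_add distrib_left[of \<eta> c t])
qed

text \<open>The polynomial factor in |t| is absorbed by giving up \<open>\<eta>\<close> in the decay
  rate.\<close>

lemma cmod_Gamma_right_line_exp:
  assumes "\<eta> > 0"
  obtains c where "c \<ge> 0" "\<And>t. cmod (Gamma (Complex (real k + 1/2) t)) \<le> c * exp (- (pi / 2 - \<eta>) * \<bar>t\<bar>)"
proof
  let ?c = "sqrt (2 * pi) * (fact k / \<eta> ^ k * exp (\<eta> * real k))"
  show "?c \<ge> 0" using assms by auto
  fix t
  have "sqrt (2 * pi) * (real k + \<bar>t\<bar>) ^ k * exp (- (pi / 2) * \<bar>t\<bar>)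
     \<le> sqrt (2 * pi) * (fact k / \<eta> ^ k * exp (\<eta> * real k) * exp (\<eta> * \<bar>t\<bar>)) * exp (- (pi / 2) * \<bar>t\<bar>)"
    using assms by (intro mult_right_mono mult_left_mono power_le_exp) auto
  also have "\<dots> = ?c * exp (- (pi / 2 - \<eta>) * \<bar>t\<bar>)"
    by (simp add: algebra_simps flip: exp_add)
  finally show "cmod (Gamma (Complex (real k + 1/2) t)) \<le> ?c * exp (- (pi / 2 - \<eta>) * \<bar>t\<bar>)"
    using cmod_Gamma_right_line order_trans by blast
qed

text \<open>For |t| at least 1 every factor z in the functional equation has modulus at least
  1.\<close>

lemma cmod_Gamma_le_shift:
  assumes "\<bar>t\<bar> \<ge> 1"
  shows "cmod (Gamma (Complex x t)) \<le> cmod (Gamma (Complex (x + real N) t))"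
proof (induction N)
  case (Suc N)
  define z where "z = Complex (x + real N) t"
  have z1: "Complex (x + real (Suc N)) t = z + 1" by (simp add: z_def complex_eq_iff)
  have nz: "z \<notin> \<int>\<^sub>\<le>\<^sub>0" unfolding z_def using assms by (intro Complex_notin_nonpos_Ints) auto
  have "1 \<le> cmod z" using abs_Im_le_cmod[of z] assms by (simp add: z_def)
  hence "cmod (Gamma z) \<le> cmod (Gamma (z + 1))"
    unfolding Gamma_plus1[OF nz] norm_mult by (simp add: mult_le_cancel_right1)
  then show ?case using Suc unfolding z1 z_def[symmetric] by simp
qed auto

text \<open>Shifting by N moves the strip into 1/2 <= Re s <= X, where monotonicity of |Gamma(x +
  it)| / Gamma(x) reduces every abscissa to the line Re s = X. Real Gamma is bounded on the compact
  interval between.\<close>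

lemma cmod_Gamma_strip_exp:
  assumes "\<eta> > 0"
  obtains c where "c \<ge> 0"
    "\<And>x t. 1/2 - real N \<le> x \<Longrightarrow> x \<le> real k + 1/2 \<Longrightarrow> \<bar>t\<bar> \<ge> 1
        \<Longrightarrow> cmod (Gamma (Complex x t)) \<le> c * exp (- (pi / 2 - \<eta>) * \<bar>t\<bar>)"
proof -
  \<comment> \<open>The right edge after the shift is again a half-integer, so the bound on right
    lines applies to it.\<close>
  define X where "X = real (N + k) + 1/2"
  obtain c where c: "c \<ge> 0"
    "\<And>t. cmod (Gamma (Complex X t)) \<le> c * exp (- (pi / 2 - \<eta>) * \<bar>t\<bar>)"
    using cmod_Gamma_right_line_exp[OF assms, of "N + k"] unfolding X_def by metis
  have "continuous_on {1/2..X} (Gamma :: real \<Rightarrow> real)"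
    by (intro continuous_on_Gamma) (auto elim!: nonpos_Ints_cases)
  hence "bounded ((Gamma :: real \<Rightarrow> real) ` {1/2..X})"
    by (intro compact_imp_bounded compact_continuous_image) auto
  then obtain M where M: "\<And>x. x \<in> {1/2..X} \<Longrightarrow> norm (Gamma x) \<le> M"
    unfolding bounded_iff by blast
  have GX: "Gamma X > 0" by (rule Gamma_real_pos) (simp add: X_def add_nonneg_pos)
  have "1/2 \<in> {1/2..X}" by (simp add: X_def)
  hence M0: "M \<ge> 0" using M norm_ge_zero order_trans by blast
  show thesis
  proof (rule that)
    show "M / Gamma X * c \<ge> 0" using M0 GX c by auto
    fix x t :: real
    assume x: "1/2 - real N \<le> x" "x \<le> real k + 1/2" and t: "\<bar>t\<bar> \<ge> 1"
    define y where "y = x + real N"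
    have y: "1/2 \<le> y" "y \<le> X" using x by (auto simp: y_def X_def)
    have "cmod (Gamma (Complex x t)) \<le> cmod (Gamma (Complex y t))"
      unfolding y_def by (rule cmod_Gamma_le_shift[OF t])
    also have "\<dots> \<le> Gamma y * cmod (Gamma (Complex X t)) / Gamma X"
      using cmod_Gamma_mono[of y X t] y GX by (simp add: field_simps)
    also have "\<dots> \<le> M * (c * exp (- (pi / 2 - \<eta>) * \<bar>t\<bar>)) / Gamma X"
      using M[of y] y GX M0 c(2)[of t] by (intro divide_right_mono mult_mono) auto
    finally show "cmod (Gamma (Complex x t)) \<le> M / Gamma X * c * exp (- (pi / 2 - \<eta>) * \<bar>t\<bar>)"
      by simp
  qed
qed

section \<open>Integrals along vertical segments\<close>

lemma has_integral_exp_neg: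
  fixes \<eta> T :: real
  assumes "\<eta> > 0" "T > 0"
  shows "((\<lambda>t. exp (- \<eta> * \<bar>t\<bar>)) has_integral 2 * (1 - exp (- \<eta> * T)) / \<eta>) {-T..T}"
proof -
  have "((\<lambda>t. exp (\<eta> * t)) has_integral exp (\<eta> * 0) / \<eta> - exp (\<eta> * (-T)) / \<eta>) {-T..0}"
    using assms by (intro fundamental_theorem_of_calculus)
      (auto intro!: derivative_eq_intros simp flip: has_real_derivative_iff_has_vector_derivative)
  hence 1: "((\<lambda>t. exp (- \<eta> * \<bar>t\<bar>)) has_integral (1 - exp (- \<eta> * T)) / \<eta>) {-T..0}"
    by (rule has_integral_eq_rhs[OF has_integral_eq[rotated]]) (use assms in \<open>auto simp: field_simps\<close>)
  have "((\<lambda>t. exp (- \<eta> * t)) has_integral (- exp (- \<eta> * T) / \<eta>) - (- exp (- \<eta> * 0) / \<eta>)) {0..T}"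
    using assms by (intro fundamental_theorem_of_calculus)
      (auto intro!: derivative_eq_intros simp flip: has_real_derivative_iff_has_vector_derivative)
  hence 2: "((\<lambda>t. exp (- \<eta> * \<bar>t\<bar>)) has_integral (1 - exp (- \<eta> * T)) / \<eta>) {0..T}"
    by (rule has_integral_eq_rhs[OF has_integral_eq[rotated]]) (use assms in \<open>auto simp: field_simps\<close>)
  have 3: "2 * (1 - exp (- \<eta> * T)) / \<eta> = (1 - exp (- \<eta> * T)) / \<eta> + (1 - exp (- \<eta> * T)) / \<eta>"
    by simp
  show ?thesis unfolding 3
    by (rule has_integral_combine[OF _ _ 1 2]) (use assms in auto)
qed

text \<open>The bound is free of T because exp(-\<open>\<eta>\<close> |t|) has integral
  2/\<open>\<eta>\<close> over the whole line.\<close>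

lemma contour_integral_vertical_bound:
  fixes h :: "complex \<Rightarrow> complex"
  assumes "\<eta> > 0" "T > 0" "continuous_on (closed_segment (Complex x (-T)) (Complex x T)) h"
    and bound: "\<And>t. \<bar>t\<bar> \<le> T \<Longrightarrow> cmod (h (Complex x t)) \<le> M * exp (- \<eta> * \<bar>t\<bar>)"
  shows "cmod (contour_integral (linepath (Complex x (-T)) (Complex x T)) h) \<le> 2 * M / \<eta>"
proof -
  have M: "M \<ge> 0" using bound[of 0] norm_ge_zero[of "h (Complex x 0)"] assms(2) by (auto simp del: norm_ge_zero)
  have cont: "continuous_on {-T..T} (\<lambda>t. h (Complex x t))"
    by (rule continuous_on_compose2[OF assms(3)])
       (use assms in \<open>auto intro!: continuous_intros simp: Complex_eq closed_segment_same_Re closed_segment_eq_real_ivl\<close>)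
  have "cmod (contour_integral (linepath (Complex x (-T)) (Complex x T)) h) = cmod (integral {-T..T} (\<lambda>t. h (Complex x t)))"
    using assms by (subst contour_integral_linepath_same_Re[of _ x _ "-T" T]) (auto simp: norm_mult)
  also have "\<dots> \<le> integral {-T..T} (\<lambda>t. M * exp (- \<eta> * \<bar>t\<bar>))"
    by (intro integral_norm_bound_integral integrable_continuous_real cont continuous_intros bound) auto
  also have "\<dots> = M * (2 * (1 - exp (- \<eta> * T)) / \<eta>)"
    using has_integral_exp_neg[OF assms(1,2)] by (simp add: integral_unique)
  also have "\<dots> \<le> M * (2 / \<eta>)"
    using M assms by (intro mult_left_mono divide_right_mono) auto
  finally show ?thesis by (simp add: mult_ac)
qed

section \<open>Residues of Gamma times an entire function\<close>

text \<open>The left side at 1/2 - N separates the pole -N from -(N - 1), and \<open>K\<close> >=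
  1/2 puts 0 inside, so exactly the poles 0, ..., -(N - 1) are enclosed, each with winding number
  1.\<close>

lemma contour_integral_Gamma_rectpath:
  assumes H: "H holomorphic_on UNIV" and T: "T > 0" and K: "K \<ge> 1/2"
  shows "contour_integral (rectpath (Complex (1/2 - real N) (-T)) (Complex K T)) (\<lambda>s. Gamma s * H s)
    = 2 * pi * \<i> * (\<Sum>n<N. (-1) ^ n / fact n * H (- of_nat n))"
proof -
  define a where "a = Complex (1/2 - real N) (-T)"
  define b where "b = Complex K T"
  define P where "P = (\<lambda>n. - complex_of_nat n) ` {..<N}"
  \<comment> \<open>This half-plane contains the closed rectangle, and its only poles of Gamma are
    those in \<open>P\<close>.\<close>
  define S where "S = {s::complex. Re s > - real N}"
  have ab: "Re a \<le> Re b" "Im a \<le> Im b" using T K by (auto simp: a_def b_def)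
  have SP: "S \<inter> \<int>\<^sub>\<le>\<^sub>0 \<subseteq> P"
  proof
    fix s assume s: "s \<in> S \<inter> \<int>\<^sub>\<le>\<^sub>0"
    then obtain n where "s = - of_nat n" by (auto elim: nonpos_Ints_cases')
    thus "s \<in> P" using s by (auto simp: S_def P_def)
  qed
  have inside: "P \<subseteq> box a b"
    using T K by (auto simp: P_def in_box_complex_iff a_def b_def)
  have "contour_integral (rectpath a b) (\<lambda>s. Gamma s * H s)
    = 2 * pi * \<i> * (\<Sum>p\<in>P. winding_number (rectpath a b) p * residue (\<lambda>s. Gamma s * H s) p)"
  proof (rule Residue_theorem)
    show "open S" "connected S"
      unfolding S_def by (auto intro!: open_halfspace_Re_gt convex_connected convex_halfspace_Re_gt)
    show "finite P" by (simp add: P_def)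
    show "(\<lambda>s. Gamma s * H s) holomorphic_on S - P"
      using SP by (intro holomorphic_intros holomorphic_on_subset[OF H]) auto
    have "path_image (rectpath a b) \<subseteq> cbox a b"
      using ab by (rule path_image_rectpath_subset_cbox)
    moreover have cbox: "cbox a b \<subseteq> S"
      by (auto simp: S_def in_cbox_complex_iff a_def)
    moreover have "path_image (rectpath a b) \<inter> box a b = {}"
      using ab by (rule path_image_rectpath_inter_box)
    ultimately show "path_image (rectpath a b) \<subseteq> S - P" using inside by blast
    show "\<forall>z. z \<notin> S \<longrightarrow> winding_number (rectpath a b) z = 0"
      using cbox ab by (auto intro!: winding_number_rectpath_outside)
  qed auto
  also have "(\<Sum>p\<in>P. winding_number (rectpath a b) p * residue (\<lambda>s. Gamma s * H s) p)
      = (\<Sum>p\<in>P. residue (\<lambda>s. Gamma s * H s) p)"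
    using inside by (intro sum.cong refl) (auto simp: winding_number_rectpath subset_iff)
  also have "\<dots> = (\<Sum>n<N. residue (\<lambda>s. Gamma s * H s) (- of_nat n))"
    unfolding P_def by (subst sum.reindex) (auto simp: inj_on_def)
  also have "\<dots> = (\<Sum>n<N. (-1) ^ n / fact n * H (- of_nat n))"
  proof (intro sum.cong refl residue_simple')
    fix n
    \<comment> \<open>All other poles are removed, so -n is the only possible singularity in
      \<open>?U\<close>.\<close>
    let ?U = "- (\<int>\<^sub>\<le>\<^sub>0 - {- complex_of_nat n})"
    show "open ?U"
      by (intro open_Compl closed_subset_Ints) (auto elim!: nonpos_Ints_cases)
    show "- complex_of_nat n \<in> ?U" by simp
    show "(\<lambda>s. Gamma s * H s) holomorphic_on ?U - {- of_nat n}"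
      by (intro holomorphic_intros holomorphic_on_subset[OF H]) auto
    have "H \<midarrow>(- of_nat n)\<rightarrow> H (- of_nat n)"
      using holomorphic_on_imp_continuous_on[OF H] by (simp add: continuous_on_eq_continuous_at isCont_def)
    from tendsto_mult[OF Gamma_residues this]
    show "(\<lambda>w. Gamma w * H w * (w - - of_nat n)) \<midarrow>(- of_nat n)\<rightarrow> (-1) ^ n / fact n * H (- of_nat n)"
      by (simp add: mult_ac)
  qed
  finally show ?thesis unfolding a_def b_def .
qed

section \<open>The Mellin-Barnes integrand on the sides of the rectangle\<close>

text \<open>The integrand of the Mellin--Barnes integral for \<open>f (- w)\<close>, where \<open>w = exp L\<close> and
  \<open>G\<close> interpolates the coefficients.\<close>
definition mb :: "(complex \<Rightarrow> complex) \<Rightarrow> complex \<Rightarrow> complex \<Rightarrow> complex" where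
  "mb G L s = Gamma s * (G (- s) * exp (- s * L))"

lemma continuous_on_mb:
  assumes "G holomorphic_on UNIV" "A \<inter> \<int>\<^sub>\<le>\<^sub>0 = {}"
  shows "continuous_on A (mb G L)"
proof -
  have "continuous_on UNIV G" using assms(1) by (rule holomorphic_on_imp_continuous_on)
  hence "continuous_on A (\<lambda>s. G (- s))"
    by (rule continuous_on_compose2) (auto intro!: continuous_intros)
  thus ?thesis unfolding mb_def using assms(2) by (intro continuous_intros)
qed

text \<open>The rates in |t| add up: -(pi/2 - \<open>\<eta>\<close>) from Gamma,
  \<open>\<eta>\<close> from \<open>G\<close>, and at most pi/2 - 4\<open>\<eta>\<close> from the
  exponential, in total -2\<open>\<eta>\<close>. The condition x <= \<open>K\<close> places -s in
  the half-plane where the growth bound holds.\<close>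

lemma cmod_mb_le:
  assumes growth: "\<And>\<zeta>. Re \<zeta> \<ge> - K \<Longrightarrow> cmod (G \<zeta>) \<le> E * exp (\<eta> * cmod \<zeta>)"
    and "\<eta> > 0" "E \<ge> 0" and \<theta>: "\<bar>\<theta>\<bar> \<le> pi / 2 - 4 * \<eta>" and x: "x \<le> K"
    and Gamma: "cmod (Gamma (Complex x t)) \<le> c * exp (- (pi / 2 - \<eta>) * \<bar>t\<bar>)"
  shows "cmod (mb G (Complex l \<theta>) (Complex x t)) \<le> c * E * exp (\<eta> * \<bar>x\<bar> - x * l) * exp (- (2 * \<eta>) * \<bar>t\<bar>)"
proof -
  define s where "s = Complex x t"
  have "cmod (- s) \<le> \<bar>x\<bar> + \<bar>t\<bar>" using cmod_le[of "- s"] by (simp add: s_def)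
  hence "E * exp (\<eta> * cmod (- s)) \<le> E * exp (\<eta> * (\<bar>x\<bar> + \<bar>t\<bar>))"
    using assms(2,3) by (intro mult_left_mono) auto
  with growth[of "- s"] x have "cmod (G (- s)) \<le> E * exp (\<eta> * (\<bar>x\<bar> + \<bar>t\<bar>))"
    by (simp add: s_def)
  moreover have "t * \<theta> \<le> \<bar>t\<bar> * (pi / 2 - 4 * \<eta>)"
    using mult_left_mono[OF \<theta>, of "\<bar>t\<bar>"] abs_ge_self[of "t * \<theta>"] unfolding abs_mult by simp
  hence "cmod (exp (- s * Complex l \<theta>)) \<le> exp (- x * l + \<bar>t\<bar> * (pi / 2 - 4 * \<eta>))"
    by (simp add: s_def)
  moreover have "0 \<le> c * exp (- (pi / 2 - \<eta>) * \<bar>t\<bar>)"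
    using Gamma norm_ge_zero order_trans by blast
  ultimately have "cmod (mb G (Complex l \<theta>) s) \<le> (c * exp (- (pi / 2 - \<eta>) * \<bar>t\<bar>))
     * ((E * exp (\<eta> * (\<bar>x\<bar> + \<bar>t\<bar>))) * exp (- x * l + \<bar>t\<bar> * (pi / 2 - 4 * \<eta>)))"
    unfolding mb_def norm_mult using Gamma assms(2,3)
    by (intro mult_mono) (auto simp: s_def)
  also have "\<dots> = c * E * exp (- (pi / 2 - \<eta>) * \<bar>t\<bar> + \<eta> * (\<bar>x\<bar> + \<bar>t\<bar>) + (- x * l + \<bar>t\<bar> * (pi / 2 - 4 * \<eta>)))"
    by (simp only: exp_add mult_ac)
  also have "\<dots> = c * E * exp ((\<eta> * \<bar>x\<bar> - x * l) + (- (2 * \<eta>) * \<bar>t\<bar>))"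
    by (rule arg_cong[of _ _ "\<lambda>u. c * E * exp u"]) (simp add: algebra_simps)
  also have "\<dots> = c * E * exp (\<eta> * \<bar>x\<bar> - x * l) * exp (- (2 * \<eta>) * \<bar>t\<bar>)"
    by (simp only: exp_add mult_ac)
  finally show ?thesis unfolding s_def .
qed

text \<open>Length of the segment times the supremum of the integrand. Apart from the decaying
  exponential the bound is independent of t, so these sides vanish in the limit.\<close>

lemma contour_integral_mb_horizontal:
  assumes hol: "G holomorphic_on UNIV"
    and growth: "\<And>\<zeta>. Re \<zeta> \<ge> - K \<Longrightarrow> cmod (G \<zeta>) \<le> E * exp (\<eta> * cmod \<zeta>)"
    and "\<eta> > 0" "E \<ge> 0" "c \<ge> 0" and \<theta>: "\<bar>\<theta>\<bar> \<le> pi / 2 - 4 * \<eta>"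
    and Gamma: "\<And>x t. J \<le> x \<Longrightarrow> x \<le> K \<Longrightarrow> \<bar>t\<bar> \<ge> 1
        \<Longrightarrow> cmod (Gamma (Complex x t)) \<le> c * exp (- (pi / 2 - \<eta>) * \<bar>t\<bar>)"
    and uv: "u \<in> {J..K}" "v \<in> {J..K}" and t: "\<bar>t\<bar> \<ge> 1"
  shows "cmod (contour_integral (linepath (Complex u t) (Complex v t)) (mb G (Complex l \<theta>)))
     \<le> c * E * exp ((\<eta> + \<bar>l\<bar>) * (\<bar>J\<bar> + \<bar>K\<bar>)) * (K - J) * exp (- (2 * \<eta>) * \<bar>t\<bar>)"
proof -
  have seg: "s = Complex (Re s) t \<and> Re s \<in> {J..K}"
    if "s \<in> closed_segment (Complex u t) (Complex v t)" for s
    using that uv by (auto simp: closed_segment_same_Im closed_segment_eq_real_ivl complex_eq_iff split: if_splits)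
  define B where "B = c * E * exp ((\<eta> + \<bar>l\<bar>) * (\<bar>J\<bar> + \<bar>K\<bar>)) * exp (- (2 * \<eta>) * \<bar>t\<bar>)"
  have B: "B \<ge> 0" using assms by (simp add: B_def)
  have "cmod (contour_integral (linepath (Complex u t) (Complex v t)) (mb G (Complex l \<theta>)))
     \<le> B * cmod (Complex v t - Complex u t)"
  proof (rule contour_integral_bound_linepath)
    have "closed_segment (Complex u t) (Complex v t) \<inter> \<int>\<^sub>\<le>\<^sub>0 = {}"
      using seg Complex_notin_nonpos_Ints t by (metis abs_0 disjoint_iff not_one_le_zero)
    thus "mb G (Complex l \<theta>) contour_integrable_on linepath (Complex u t) (Complex v t)"
      by (intro contour_integrable_continuous_linepath continuous_on_mb hol)
    fix s assume "s \<in> closed_segment (Complex u t) (Complex v t)"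
    then obtain x where s: "s = Complex x t" and x: "x \<in> {J..K}" using seg by blast
    have "cmod (mb G (Complex l \<theta>) s) \<le> c * E * exp (\<eta> * \<bar>x\<bar> - x * l) * exp (- (2 * \<eta>) * \<bar>t\<bar>)"
      unfolding s using assms x by (intro cmod_mb_le[where K = K]) auto
    \<comment> \<open>The exponent is made uniform in x over the whole strip, at the cost of a
      constant depending on l.\<close>
    also have "\<eta> * \<bar>x\<bar> - x * l \<le> (\<eta> + \<bar>l\<bar>) * \<bar>x\<bar>"
      using abs_ge_minus_self[of "x * l"] by (simp add: abs_mult algebra_simps)
    also have "\<dots> \<le> (\<eta> + \<bar>l\<bar>) * (\<bar>J\<bar> + \<bar>K\<bar>)"
      using x assms(3) by (intro mult_left_mono) auto
    finally show "cmod (mb G (Complex l \<theta>) s) \<le> B"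
      using assms by (auto simp: B_def mult_left_mono mult_right_mono)
  qed (rule B)
  also have "\<dots> = B * \<bar>v - u\<bar>"
    by (simp add: cmod_def)
  also have "\<dots> \<le> B * (K - J)"
    using B uv by (intro mult_left_mono) auto
  finally show ?thesis by (simp add: B_def mult_ac)
qed

text \<open>Unlike a horizontal side, this one crosses the real axis, so the abscissa must avoid the
  poles and the Gamma bound is required for all t.\<close>

lemma contour_integral_mb_vertical:
  assumes hol: "G holomorphic_on UNIV"
    and growth: "\<And>\<zeta>. Re \<zeta> \<ge> - K \<Longrightarrow> cmod (G \<zeta>) \<le> E * exp (\<eta> * cmod \<zeta>)"
    and "\<eta> > 0" "E \<ge> 0" and \<theta>: "\<bar>\<theta>\<bar> \<le> pi / 2 - 4 * \<eta>" and x: "x \<le> K" and "T > 0"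
    and regular: "\<And>t. Complex x t \<notin> \<int>\<^sub>\<le>\<^sub>0"
    and Gamma: "\<And>t. cmod (Gamma (Complex x t)) \<le> c * exp (- (pi / 2 - \<eta>) * \<bar>t\<bar>)"
  shows "cmod (contour_integral (linepath (Complex x (-T)) (Complex x T)) (mb G (Complex l \<theta>)))
     \<le> c * E * exp (\<eta> * \<bar>x\<bar> - x * l) / \<eta>"
proof -
  have "s \<notin> \<int>\<^sub>\<le>\<^sub>0" if "s \<in> closed_segment (Complex x (-T)) (Complex x T)" for s
  proof -
    have "s = Complex x (Im s)" using that by (auto simp: closed_segment_same_Re complex_eq_iff)
    thus ?thesis using regular by metis
  qed
  hence "continuous_on (closed_segment (Complex x (-T)) (Complex x T)) (mb G (Complex l \<theta>))"
    by (intro continuous_on_mb hol) auto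
  hence "cmod (contour_integral (linepath (Complex x (-T)) (Complex x T)) (mb G (Complex l \<theta>)))
     \<le> 2 * (c * E * exp (\<eta> * \<bar>x\<bar> - x * l)) / (2 * \<eta>)"
    using assms by (intro contour_integral_vertical_bound cmod_mb_le[where K = K]) auto
  thus ?thesis by simp
qed

section \<open>From contour integrals to the alternating series\<close>

text \<open>The two summands bound the right side at Re s = \<open>K\<close> and the left side at Re
  s = 1/2 - N; the horizontal sides disappear as T tends to infinity.\<close>

lemma cmod_alternating_partial_sum_le:
  assumes hol: "G holomorphic_on UNIV"
    and growth: "\<And>\<zeta>. Re \<zeta> \<ge> - K \<Longrightarrow> cmod (G \<zeta>) \<le> E * exp (\<eta> * cmod \<zeta>)"
    and \<eta>: "\<eta> > 0" and E: "E \<ge> 0" and \<theta>: "\<bar>\<theta>\<bar> \<le> pi / 2 - 4 * \<eta>"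
    and K: "K = real k + 1/2"
    and Gamma: "\<And>t. cmod (Gamma (Complex K t)) \<le> c * exp (- (pi / 2 - \<eta>) * \<bar>t\<bar>)"
  shows "2 * pi * cmod (\<Sum>n<N. (-1) ^ n / fact n * (G (of_nat n) * exp (of_nat n * Complex l \<theta>)))
     \<le> c * E * exp (\<eta> * K - K * l) / \<eta>
       + sqrt (2 * pi) * (2 ^ N / fact N) * E * exp ((\<eta> + \<bar>l\<bar>) * (real N + 1)) / \<eta>"
    (is "2 * pi * cmod ?S \<le> ?R + ?L")
proof -
  define h where "h = mb G (Complex l \<theta>)"
  define J where "J = 1/2 - real N"
  obtain d where d: "d \<ge> 0" "\<And>x t. J \<le> x \<Longrightarrow> x \<le> K \<Longrightarrow> \<bar>t\<bar> \<ge> 1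
        \<Longrightarrow> cmod (Gamma (Complex x t)) \<le> d * exp (- (pi / 2 - \<eta>) * \<bar>t\<bar>)"
    using cmod_Gamma_strip_exp[OF \<eta>] unfolding J_def K by metis
  \<comment> \<open>This constant depends on N, k and l but not on T.\<close>
  define B where "B = d * E * exp ((\<eta> + \<bar>l\<bar>) * (\<bar>J\<bar> + \<bar>K\<bar>)) * (K - J)"
  have JK: "J \<le> K" by (simp add: J_def K)
  have *: "2 * pi * cmod ?S \<le> ?R + ?L + 2 * B * exp (- (2 * \<eta>) * T)" if T: "T \<ge> 1" for T
  proof -
    let ?I = "\<lambda>a b. contour_integral (linepath a b) h"
    let ?a = "Complex J (-T)" and ?b = "Complex K (-T)" and ?c = "Complex K T" and ?d = "Complex J T"
    \<comment> \<open>Unordered pairs of corners cover both orientations of each side, as needed for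
      the reversal of the left side.\<close>
    have cont: "continuous_on (closed_segment a b) h"
      if "{a, b} \<in> {{?a, ?b}, {?b, ?c}, {?c, ?d}, {?d, ?a}}" for a b
    proof -
      have "s \<notin> \<int>\<^sub>\<le>\<^sub>0" if s: "s \<in> closed_segment a b" for s
      proof -
        have "Re s = J \<or> Re s = K \<or> Im s = T \<or> Im s = - T"
          using s \<open>{a, b} \<in> _\<close>
          by (auto simp: doubleton_eq_iff closed_segment_same_Re closed_segment_same_Im)
        hence "Re s = J \<or> Re s > 0 \<or> Im s \<noteq> 0" using T by (auto simp: K)
        thus ?thesis
          using half_integer_notin_nonpos_Ints[of N "Im s"] Complex_notin_nonpos_Ints[of "Re s" "Im s"]
          by (cases s) (auto simp: J_def)
      qed
      thus ?thesis unfolding h_def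
        by (intro continuous_on_mb hol) auto
    qed
    have edges: "h contour_integrable_on linepath ?a ?b" "h contour_integrable_on linepath ?b ?c"
      "h contour_integrable_on linepath ?c ?d" "h contour_integrable_on linepath ?d ?a"
      by (intro contour_integrable_continuous_linepath cont; simp)+
    \<comment> \<open>The double negation exhibits the summands as values at -n of the entire factor
      G(-s) exp(-sL).\<close>
    have "2 * pi * \<i> * ?S = 2 * pi * \<i> * (\<Sum>n<N. (-1) ^ n / fact n *
        (G (- (- of_nat n)) * exp (- (- of_nat n) * Complex l \<theta>)))" by simp
    also have "\<dots> = contour_integral (rectpath ?a ?c) h"
      unfolding h_def mb_def J_def
      by (rule contour_integral_Gamma_rectpath[symmetric])
         (use T in \<open>auto intro!: holomorphic_intros holomorphic_on_compose_gen[OF _ hol, unfolded o_def] simp: K\<close>)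
    also have "\<dots> = ?I ?a ?b + (?I ?b ?c + (?I ?c ?d + ?I ?d ?a))"
      unfolding rectpath_def Let_def complex.sel using edges by simp
    also have "?I ?d ?a = - ?I ?a ?d"
      by (intro contour_integral_reverse_linepath cont) simp
    finally have eq: "2 * pi * \<i> * ?S = ?I ?a ?b + (?I ?b ?c + (?I ?c ?d + - ?I ?a ?d))" .
    have "2 * pi * cmod ?S = cmod (2 * pi * \<i> * ?S)"
      unfolding norm_mult by simp
    also have "\<dots> = cmod (?I ?a ?b + (?I ?b ?c + (?I ?c ?d + - ?I ?a ?d)))"
      by (rule arg_cong[OF eq])
    also have "\<dots> \<le> cmod (?I ?b ?c) + cmod (?I ?a ?d) + cmod (?I ?a ?b) + cmod (?I ?c ?d)"
      by norm
    also have "cmod (?I ?b ?c) \<le> c * E * exp (\<eta> * \<bar>K\<bar> - K * l) / \<eta>"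
      unfolding h_def using assms T
      by (intro contour_integral_mb_vertical[where K = K] Complex_notin_nonpos_Ints) auto
    also have "\<dots> = ?R" by (simp add: K)
    also have "cmod (?I ?a ?d) \<le> sqrt (2 * pi) * (2 ^ N / fact N) * E * exp (\<eta> * \<bar>J\<bar> - J * l) / \<eta>"
      unfolding h_def
    proof (rule contour_integral_mb_vertical[OF hol growth \<eta> E \<theta> JK])
      show "Complex J t \<notin> \<int>\<^sub>\<le>\<^sub>0" for t unfolding J_def by (rule half_integer_notin_nonpos_Ints)
      fix t
      have "- (pi / 2) * \<bar>t\<bar> \<le> - (pi / 2 - \<eta>) * \<bar>t\<bar>" using \<eta> by (simp add: algebra_simps)
      hence "sqrt (2 * pi) * (2 ^ N / fact N) * exp (- (pi / 2) * \<bar>t\<bar>)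
          \<le> sqrt (2 * pi) * (2 ^ N / fact N) * exp (- (pi / 2 - \<eta>) * \<bar>t\<bar>)"
        by (intro mult_left_mono) auto
      thus "cmod (Gamma (Complex J t)) \<le> sqrt (2 * pi) * (2 ^ N / fact N) * exp (- (pi / 2 - \<eta>) * \<bar>t\<bar>)"
        using cmod_Gamma_left_line[of N t] unfolding J_def by linarith
    qed (use T in auto)
    also have "\<dots> \<le> ?L"
    proof -
      have "\<eta> * \<bar>J\<bar> - J * l \<le> (\<eta> + \<bar>l\<bar>) * \<bar>J\<bar>"
        using abs_ge_minus_self[of "J * l"] by (simp add: abs_mult algebra_simps)
      also have "\<dots> \<le> (\<eta> + \<bar>l\<bar>) * (real N + 1)"
        using \<eta> by (intro mult_left_mono) (auto simp: J_def)
      finally show ?thesis using \<eta> E by (intro divide_right_mono mult_left_mono) auto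
    qed
    also have "cmod (?I ?a ?b) \<le> d * E * exp ((\<eta> + \<bar>l\<bar>) * (\<bar>J\<bar> + \<bar>K\<bar>)) * (K - J) * exp (- (2 * \<eta>) * \<bar>-T\<bar>)"
      unfolding h_def by (rule contour_integral_mb_horizontal[OF hol growth \<eta> E d(1) \<theta> d(2)]) (use JK T in auto)
    also have "\<dots> = B * exp (- (2 * \<eta>) * T)" using T by (simp add: B_def)
    also have "cmod (?I ?c ?d) \<le> d * E * exp ((\<eta> + \<bar>l\<bar>) * (\<bar>J\<bar> + \<bar>K\<bar>)) * (K - J) * exp (- (2 * \<eta>) * \<bar>T\<bar>)"
      unfolding h_def by (rule contour_integral_mb_horizontal[OF hol growth \<eta> E d(1) \<theta> d(2)]) (use JK T in auto)
    also have "\<dots> = B * exp (- (2 * \<eta>) * T)" using T by (simp add: B_def)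
    finally show ?thesis by simp
  qed
  \<comment> \<open>The sum does not depend on T, so the bound passes to the limit.\<close>
  have "((\<lambda>T. exp (- (2 * \<eta>) * T)) \<longlongrightarrow> 0) at_top"
    using \<eta> by (intro filterlim_compose[OF exp_at_bot] filterlim_tendsto_neg_mult_at_bot[OF tendsto_const] filterlim_ident) auto
  hence "((\<lambda>T. ?R + ?L + 2 * B * exp (- (2 * \<eta>) * T)) \<longlongrightarrow> ?R + ?L + 2 * B * 0) at_top"
    by (intro tendsto_intros)
  moreover have "\<forall>\<^sub>F T in at_top. 2 * pi * cmod ?S \<le> ?R + ?L + 2 * B * exp (- (2 * \<eta>) * T)"
    using eventually_ge_at_top[of 1] by eventually_elim (rule *)
  ultimately show ?thesis
    by (intro tendsto_lowerbound[where F = at_top and f = "\<lambda>T. ?R + ?L + 2 * B * exp (- (2 * \<eta>) * T)"]) auto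
qed

text \<open>For fixed l the contribution of the left side is a constant times (2q)^N / N! with q =
  exp(\<open>\<eta>\<close> + |l|). It tends to 0, so only the right side survives.\<close>

lemma cmod_alternating_series_le:
  assumes hol: "G holomorphic_on UNIV"
    and growth: "\<And>\<zeta>. Re \<zeta> \<ge> - K \<Longrightarrow> cmod (G \<zeta>) \<le> E * exp (\<eta> * cmod \<zeta>)"
    and \<eta>: "\<eta> > 0" and E: "E \<ge> 0" and \<theta>: "\<bar>\<theta>\<bar> \<le> pi / 2 - 4 * \<eta>"
    and K: "K = real k + 1/2"
    and Gamma: "\<And>t. cmod (Gamma (Complex K t)) \<le> c * exp (- (pi / 2 - \<eta>) * \<bar>t\<bar>)"
    and sums: "(\<lambda>n. (-1) ^ n / fact n * (G (of_nat n) * exp (of_nat n * Complex l \<theta>))) sums s"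
  shows "2 * pi * cmod s \<le> c * E * exp (\<eta> * K) / \<eta> * exp (- K * l)"
proof -
  let ?R = "c * E * exp (\<eta> * K - K * l) / \<eta>"
  let ?q = "exp (\<eta> + \<bar>l\<bar>)"
  let ?L = "\<lambda>N. sqrt (2 * pi) * (2 ^ N / fact N) * E * exp ((\<eta> + \<bar>l\<bar>) * (real N + 1)) / \<eta>"
  have "?L = (\<lambda>N. sqrt (2 * pi) * E * ?q / \<eta> * ((2 * ?q) ^ N / fact N))"
    by (rule ext) (simp add: ring_distribs exp_add power_mult_distrib exp_of_nat2_mult mult_ac divide_inverse)
  moreover have "(\<lambda>N. (2 * ?q) ^ N / fact N) \<longlonglongrightarrow> 0"
    using summable_LIMSEQ_zero[OF summable_exp_generic[of "2 * ?q"]] by (simp add: divide_inverse mult.commute)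
  ultimately have "?L \<longlonglongrightarrow> sqrt (2 * pi) * E * ?q / \<eta> * 0"
    by (simp only: tendsto_intros)
  hence upper: "(\<lambda>N. ?R + ?L N) \<longlonglongrightarrow> ?R + 0" by (intro tendsto_intros) simp
  have lower: "(\<lambda>N. 2 * pi * cmod (\<Sum>n<N. (-1) ^ n / fact n * (G (of_nat n) * exp (of_nat n * Complex l \<theta>))))
      \<longlonglongrightarrow> 2 * pi * cmod s"
    using sums unfolding sums_def by (intro tendsto_intros)
  have "2 * pi * cmod s \<le> ?R + 0"
    by (rule LIMSEQ_le[OF lower upper]) (intro exI allI impI cmod_alternating_partial_sum_le[OF hol growth \<eta> E \<theta> K Gamma])
  thus ?thesis by (simp add: exp_diff exp_minus divide_inverse mult_ac)
qed

section \<open>Growth of the interpolating function and the decay of the series\<close>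

text \<open>Far out, |\<open>\<psi>\<close>| is at most \<open>\<eta>\<close> times the modulus; on
  the remaining disc it is bounded by compactness. The sum of both bounds dominates the real part of
  the exponent.\<close>

lemma exp_ii_growth:
  assumes entire: "\<psi> holomorphic_on UNIV"
    and small: "\<And>c::real. \<psi> \<in> o[at_infinity_right_of c](\<lambda>\<zeta>. complex_of_real (cmod \<zeta>))"
    and \<eta>: "\<eta> > 0"
  obtains E where "E \<ge> 0" "\<And>\<zeta>. Re \<zeta> \<ge> - K \<Longrightarrow> cmod (exp (\<i> * \<psi> \<zeta>)) \<le> E * exp (\<eta> * cmod \<zeta>)"
proof -
  \<comment> \<open>The open half-plane is taken one unit larger so that it contains the closed one
    Re >= -\<open>K\<close>.\<close>
  have "\<forall>\<^sub>F \<zeta> in at_infinity_right_of (- K - 1). cmod (\<psi> \<zeta>) \<le> \<eta> * cmod (complex_of_real (cmod \<zeta>))"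
    using landau_o.smallD[OF small \<eta>] .
  hence "\<exists>R. \<forall>\<zeta>. R \<le> cmod \<zeta> \<longrightarrow> Re \<zeta> > - K - 1 \<longrightarrow> cmod (\<psi> \<zeta>) \<le> \<eta> * cmod \<zeta>"
    by (simp add: at_infinity_right_of_def eventually_inf_principal eventually_at_infinity)
  then obtain R where R: "\<And>\<zeta>. R \<le> cmod \<zeta> \<Longrightarrow> Re \<zeta> > - K - 1 \<Longrightarrow> cmod (\<psi> \<zeta>) \<le> \<eta> * cmod \<zeta>"
    by blast
  have "bounded (\<psi> ` cball 0 R)"
    using holomorphic_on_subset[OF entire]
    by (intro compact_imp_bounded compact_continuous_image holomorphic_on_imp_continuous_on) auto
  then obtain B where "\<forall>\<zeta>\<in>cball 0 R. cmod (\<psi> \<zeta>) \<le> B"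
    unfolding bounded_iff by blast
  hence B: "cmod (\<psi> \<zeta>) \<le> B" if "cmod \<zeta> \<le> R" for \<zeta>
    using that by simp
  show thesis
  proof
    show "exp \<bar>B\<bar> \<ge> 0" by simp
    fix \<zeta> assume \<zeta>: "Re \<zeta> \<ge> - K"
    have "cmod (\<psi> \<zeta>) \<le> \<bar>B\<bar> + \<eta> * cmod \<zeta>"
    proof (cases "cmod \<zeta> \<le> R")
      case True
      have "0 \<le> \<eta> * cmod \<zeta>" using \<eta> by simp
      with B[OF True] show ?thesis by linarith
    next
      case False
      with R[of \<zeta>] \<zeta> show ?thesis by linarith
    qed
    hence "Re (\<i> * \<psi> \<zeta>) \<le> \<bar>B\<bar> + \<eta> * cmod \<zeta>"
      using abs_Im_le_cmod[of "\<psi> \<zeta>"] by simp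
    thus "cmod (exp (\<i> * \<psi> \<zeta>)) \<le> exp \<bar>B\<bar> * exp (\<eta> * cmod \<zeta>)"
      by (simp flip: exp_add)
  qed
qed

theorem theorem2:
  fixes \<psi> f :: "complex \<Rightarrow> complex" and a :: "nat \<Rightarrow> complex"
  assumes psi_real_entire: "real_entire \<psi>"
    and psi_small: "\<And>c::real. \<psi> \<in> o[at_infinity_right_of c](\<lambda>\<zeta>. complex_of_real (cmod \<zeta>))"
    and a_eq: "\<And>n. a n = exp (\<i> * \<psi> (of_nat n))"
    and f_eq: "\<And>z. f z = (\<Sum>n. a n / fact n * z ^ n)"
  shows "f holomorphic_on UNIV \<and>
    (\<forall>n. cmod (a n) = 1) \<and>
    (\<forall>z. (\<lambda>n. a n / fact n * z ^ n) sums f z) \<and>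
    (\<forall>A>0. \<forall>\<epsilon>>0. \<exists>C::real. \<forall>\<^sub>F r::real in at_top. \<forall>\<phi>::real.
       \<bar>\<phi> - pi\<bar> \<le> pi / 2 - \<epsilon> \<longrightarrow>
       cmod (f (complex_of_real r * exp (\<i> * complex_of_real \<phi>))) \<le> C * r powr (- A))"
proof (intro conjI allI impI)
  have entire: "\<psi> holomorphic_on UNIV" and real: "\<psi> (complex_of_real x) \<in> \<real>" for x
    using psi_real_entire by (auto simp: real_entire_def)
  show a1: "cmod (a n) = 1" for n
    using real[of "real n"] by (auto simp: a_eq elim!: Reals_cases)
  show sums: "(\<lambda>n. a n / fact n * z ^ n) sums f z" for z
  proof -
    have "summable (\<lambda>n. cmod (a n / fact n * z ^ n))"
      using summable_exp_generic[of "cmod z"]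
      by (simp add: norm_mult norm_divide norm_power norm_inverse a1 divide_inverse mult_ac)
    thus ?thesis unfolding f_eq by (rule summable_sums[OF summable_norm_cancel])
  qed
  show "f holomorphic_on UNIV"
  proof -
    have "f holomorphic_on ball 0 r" for r
      using sums by (intro power_series_holomorphic[where a = "\<lambda>n. a n / fact n"]) simp
    hence "f holomorphic_on (\<Union>n. ball 0 (real n))"
      by (intro holomorphic_on_UN_open) auto
    moreover have "(\<Union>n. ball 0 (real n)) = (UNIV :: complex set)"
      using reals_Archimedean2 by auto
    ultimately show ?thesis by simp
  qed
  fix A \<epsilon> :: real assume A: "A > 0" and \<epsilon>: "\<epsilon> > 0"
  \<comment> \<open>With this choice pi/2 - 4\<open>\<eta>\<close> is exactly pi/2 -
    \<open>\<epsilon>\<close>.\<close>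
  define \<eta> where "\<eta> = \<epsilon> / 4"
  have \<eta>: "\<eta> > 0" using \<epsilon> by (simp add: \<eta>_def)
  obtain k where k: "A \<le> real k" using real_arch_simple by blast
  define K where "K = real k + 1/2"
  obtain c where c: "c \<ge> 0" "\<And>t. cmod (Gamma (Complex K t)) \<le> c * exp (- (pi / 2 - \<eta>) * \<bar>t\<bar>)"
    using cmod_Gamma_right_line_exp[OF \<eta>] unfolding K_def by metis
  define G where "G = (\<lambda>\<zeta>. exp (\<i> * \<psi> \<zeta>))"
  have hol: "G holomorphic_on UNIV" unfolding G_def by (intro holomorphic_intros entire)
  obtain E where E: "E \<ge> 0" "\<And>\<zeta>. Re \<zeta> \<ge> - K \<Longrightarrow> cmod (G \<zeta>) \<le> E * exp (\<eta> * cmod \<zeta>)"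
    using exp_ii_growth[OF entire psi_small \<eta>] unfolding G_def by metis
  define C where "C = c * E * exp (\<eta> * K) / \<eta>"
  have C: "C \<ge> 0" using c E \<eta> by (simp add: C_def)
  show "\<exists>C. \<forall>\<^sub>F r in at_top. \<forall>\<phi>. \<bar>\<phi> - pi\<bar> \<le> pi / 2 - \<epsilon> \<longrightarrow>
       cmod (f (complex_of_real r * exp (\<i> * complex_of_real \<phi>))) \<le> C * r powr (- A)"
  \<comment> \<open>For r >= 1 the logarithm is nonnegative, so r^(-K) <= r^(-A). The constant
    \<open>C\<close> involves neither r nor \<open>\<phi>\<close>, which gives uniformity.\<close>
  proof (rule exI[of _ C], rule eventually_mono[OF eventually_ge_at_top[of 1]], intro allI impI)
    fix r \<phi> :: real assume r: "r \<ge> 1" and \<phi>: "\<bar>\<phi> - pi\<bar> \<le> pi / 2 - \<epsilon>"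
    define z where "z = complex_of_real r * exp (\<i> * complex_of_real \<phi>)"
    \<comment> \<open>The chosen logarithm of w = -z has imaginary part \<open>\<phi>\<close> - pi,
      the angle that the hypothesis controls.\<close>
    have "exp (Complex (ln r) (\<phi> - pi)) = - z"
      using r by (simp add: z_def Complex_eq exp_add exp_diff right_diff_distrib mult.commute[of \<i> "complex_of_real pi"] exp_of_real)
    hence "(-1) ^ n / fact n * (G (of_nat n) * exp (of_nat n * Complex (ln r) (\<phi> - pi))) = a n / fact n * z ^ n" for n
      by (simp add: exp_of_nat_mult G_def a_eq power_minus[of z])
    hence "(\<lambda>n. (-1) ^ n / fact n * (G (of_nat n) * exp (of_nat n * Complex (ln r) (\<phi> - pi)))) sums f z"
      using sums[of z] by simp
    from cmod_alternating_series_le[OF hol E(2) \<eta> E(1) _ K_def c(2) this]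
    have "2 * pi * cmod (f z) \<le> C * exp (- K * ln r)"
      using \<phi> by (simp add: \<eta>_def C_def)
    also have "- K * ln r \<le> - A * ln r"
      using r k by (intro mult_right_mono) (auto simp: K_def)
    finally have "2 * pi * cmod (f z) \<le> C * r powr (- A)"
      using r C by (simp add: powr_def mult_left_mono)
    moreover have "cmod (f z) \<le> 2 * pi * cmod (f z)"
      using pi_ge_two by (simp add: mult_le_cancel_right1)
    ultimately show "cmod (f (complex_of_real r * exp (\<i> * complex_of_real \<phi>))) \<le> C * r powr (- A)"
      unfolding z_def by linarith
  qed
qed

end
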